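(* Let $k$ be a positive integer. Let $q_1,q_2,\ldots$ be positive integers such that $q_l\mid q_{l+1}$ and $q_l<q_{l+1}$ for all $l\geq 1$. Suppose that for every $C>0$ there exists $n=n(C)$ such that \[ \frac{\log q_{n+1}}{\log q_n}>C \quad\text{and}\quad \frac{\log q_{n+2}}{\log q_{n+1}}>k+1. \] Set $\zeta=\sum_{l\geq 1} \frac{1}{q_l}$. Then \begin{align*} \lambda_{k,j}(\zeta)&=\frac{1}{j-1}, \qquad 1\leq j\leq k+1,\\ \widehat{\lambda}_{k,1}(\zeta)&=\frac{1}{k},\\ \widehat{\lambda}_{k,j}(\zeta)&=0, \qquad 2\leq j\leq k+1. \end{align*}
   Context: For $\underline{\zeta}=(\zeta_1,\ldots,\zeta_k)\in\mathbb{R}^k$ and $1\leq j\leq k+1$, $\lambda_{k,j}(\underline{\zeta})$ (resp. $\widehat{\lambda}_{k,j}(\underline{\zeta})$) is the supremum of all $\eta\in\mathbb{R}$ such that the system $|x|\leq X$, $\max_{1\leq i\leq k}|\zeta_i x-y_i|\leq X^{-\eta}$ has at least $j$ linearly independent solutions $(x,y_1,\ldots,y_k)\in\mathbb{Z}^{k+1}$ for arbitrarily large real $X$ (resp. for all sufficiently large real $X$). For a real number $\zeta$ one writes $\lambda_{k,j}(\zeta):=\lambda_{k,j}(\zeta,\zeta^2,\ldots,\zeta^k)$ and $\widehat{\lambda}_{k,j}(\zeta):=\widehat{\lambda}_{k,j}(\zeta,\zeta^2,\ldots,\zeta^k)$. Convention: $1/0=\infty$ (so the case $j=1$ of the first line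 reads $\lambda_{k,1}(\zeta)=\infty$). *)

theory Defs
  imports "HOL-Analysis.Analysis" "HOL-Library.Extended_Real"
begin

text \<open>Integer vectors (x, y_1, ..., y_k) in Z^(k+1) are represented as functions
  v :: nat => int with v 0 = x, v i = y_i for 1 <= i <= k and v i = 0 for i > k.\<close>

definition int_vec :: "nat \<Rightarrow> (nat \<Rightarrow> int) \<Rightarrow> bool" where
  "int_vec k v \<longleftrightarrow> (\<forall>i>k. v i = 0)"

text \<open>Linear independence (over the reals, equivalently over Q) of a finite list of vectors in Z^(k+1).\<close>
definition lin_indep_vecs :: "nat \<Rightarrow> (nat \<Rightarrow> int) list \<Rightarrow> bool" where
  "lin_indep_vecs k vs \<longleftrightarrow>
     (\<forall>c :: nat \<Rightarrow> real.
        (\<forall>i\<le>k. (\<Sum>m<length vs. c m * of_int ((vs ! m) i)) = 0) \<longrightarrow> (\<forall>m<length vs. c m = 0))"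

definition approx_sols :: "nat \<Rightarrow> (nat \<Rightarrow> real) \<Rightarrow> real \<Rightarrow> real \<Rightarrow> (nat \<Rightarrow> int) set" where
  "approx_sols k zeta X eta =
     {v. int_vec k v \<and> \<bar>real_of_int (v 0)\<bar> \<le> X \<and>
         (\<forall>i\<in>{1..k}. \<bar>zeta i * of_int (v 0) - of_int (v i)\<bar> \<le> X powr (- eta))}"

definition has_indep_sols :: "nat \<Rightarrow> nat \<Rightarrow> (nat \<Rightarrow> real) \<Rightarrow> real \<Rightarrow> real \<Rightarrow> bool" where
  "has_indep_sols k j zeta X eta \<longleftrightarrow>
     (\<exists>vs. length vs = j \<and> set vs \<subseteq> approx_sols k zeta X eta \<and> lin_indep_vecs k vs)"

definition lambda_exp :: "nat \<Rightarrow> nat \<Rightarrow> (nat \<Rightarrow> real) \<Rightarrow> ereal" where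
  "lambda_exp k j zeta =
     Sup (ereal ` {eta. \<forall>X0. \<exists>X\<ge>X0. has_indep_sols k j zeta X eta})"

definition lambda_hat_exp :: "nat \<Rightarrow> nat \<Rightarrow> (nat \<Rightarrow> real) \<Rightarrow> ereal" where
  "lambda_hat_exp k j zeta =
     Sup (ereal ` {eta. \<exists>X0. \<forall>X\<ge>X0. has_indep_sols k j zeta X eta})"

end

theory Submission
  imports Defs
begin

text \<open>
  The bound \<open>\<lambda>\<^sub>k\<^sub>,\<^sub>j \<le> 1/(j-1)\<close> holds for every point: small integer combinations of \<open>j\<close>
  independent solutions are determined by their first coordinate, and there are too many of them. The bound
  \<open>1/k\<close> from below for the first uniform exponent is Dirichlet's theorem.

  For the rest let \<open>b = q\<^sub>n\<close>, \<open>Q = q\<^sub>n\<^sub>+\<^sub>1\<close> for an \<open>n\<close> with \<open>Q\<close> larger than a high power of \<open>b\<close>, and let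
  \<open>a/b\<close> be the \<open>n\<close>-th partial sum. Up to an error of order at most \<open>Q\<^sup>-\<^sup>k\<^sup>-\<^sup>1\<close> the number \<open>\<zeta>\<close> equals \<open>a/b + 1/Q\<close>, so by the
  binomial theorem each \<open>x = b\<^sup>k Q\<^sup>h\<close>, \<open>h < j\<close>, has all products \<open>x \<zeta>\<^sup>i\<close> within about \<open>1/Q\<close> of integers. Since \<open>b\<close> is
  negligible against \<open>Q\<close>, this gives \<open>\<lambda>\<^sub>k\<^sub>,\<^sub>j \<ge> 1/(j-1)\<close>.

  Conversely, if \<open>\<zeta>\<close> is very close to a fraction \<open>a/b\<close>, then a solution with all errors below \<open>1/b\<close> is an exact
  multiple of \<open>(1, a/b, \<dots>, (a/b)\<^sup>k)\<close>. With the \<open>n\<close>-th partial sum and \<open>X = sqrt Q\<close> this excludes two independent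
  solutions. With the \<open>(n+1)\<close>-st partial sum in lowest terms it forces \<open>b\<^sup>k\<close> to divide \<open>x\<close>, which excludes all
  nonzero solutions for \<open>X\<close> slightly below \<open>b\<^sup>k\<close>.
\<close>

section \<open>Bounds for arbitrary points\<close>

text \<open>Integer relations are special cases of the real ones in the definition; the counting and
  divisibility arguments produce only these.\<close>

lemma lin_indep_vecs_int:
  assumes "lin_indep_vecs k vs" and "\<forall>i\<le>k. (\<Sum>m<length vs. d m * (vs ! m) i) = (0::int)" and "m < length vs"
  shows "d m = 0"
proof -
  have "\<forall>i\<le>k. (\<Sum>m<length vs. real_of_int (d m) * of_int ((vs ! m) i)) = 0"
  proof (intro allI impI)
    fix i assume "i \<le> k"
    then have "real_of_int (\<Sum>m<length vs. d m * (vs ! m) i) = 0"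
      using assms(2) by simp
    then show "(\<Sum>m<length vs. real_of_int (d m) * of_int ((vs ! m) i)) = 0"
      by simp
  qed
  then have "real_of_int (d m) = 0"
    using spec[OF assms(1)[unfolded lin_indep_vecs_def], of "\<lambda>m. real_of_int (d m)"] assms(3)
    by blast
  then show ?thesis by simp
qed

text \<open>Pigeonhole: the combinations of the solutions with coefficients in \<open>{0..H}\<close> have distinct first
  coordinates, since a combination with first coordinate \<open>0\<close> and errors below \<open>1\<close> vanishes.\<close>

lemma indep_sols_count:
  assumes "has_indep_sols k j z X \<eta>" and X: "X \<ge> 0"
    and small: "real j * real H * X powr (-\<eta>) < 1"
  shows "(real H + 1) ^ j \<le> 2 * (real j * real H * X) + 1"
proof -
  obtain vs where vs: "length vs = j" "set vs \<subseteq> approx_sols k z X \<eta>" "lin_indep_vecs k vs"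
    using assms(1) unfolding has_indep_sols_def by blast
  have sol: "vs ! m \<in> approx_sols k z X \<eta>" if "m < j" for m
    using vs that by (meson nth_mem subsetD)
  define F where "F c = (\<Sum>m<j. int (c m) * (vs ! m) 0)" for c :: "nat \<Rightarrow> nat"
  define S where "S = PiE {..<j} (\<lambda>_. {..H})"
  define M where "M = \<lfloor>real j * real H * X\<rfloor>"
  have "inj_on F S"
  proof (rule inj_onI)
    fix c c' assume c: "c \<in> S" "c' \<in> S" and eq: "F c = F c'"
    define d where "d m = int (c m) - int (c' m)" for m
    have dH: "\<bar>real_of_int (d m)\<bar> \<le> real H" if "m < j" for m
    proof -
      have "c m \<le> H" "c' m \<le> H"
        using c that unfolding S_def PiE_iff by auto
      then show ?thesis unfolding d_def by linarith
    qed
    have d0: "(\<Sum>m<j. d m * (vs ! m) 0) = 0"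
      using eq unfolding F_def d_def by (simp add: algebra_simps sum_subtractf)
    have "(\<Sum>m<j. d m * (vs ! m) i) = 0" if "i \<le> k" for i
    proof (cases "i = 0")
      case True
      then show ?thesis using d0 by simp
    next
      case False
      have d0': "(\<Sum>m<j. real_of_int (d m) * real_of_int ((vs ! m) 0)) = 0"
        using arg_cong[OF d0, of real_of_int] by simp
      \<comment> \<open>The first coordinate of the combination is \<open>0\<close>, so subtracting
        \<open>z i\<close> times it is free and turns every summand into an approximation
        error.\<close>
      have "real_of_int (\<Sum>m<j. d m * (vs ! m) i) =
          (\<Sum>m<j. of_int (d m) * of_int ((vs ! m) i)) - z i * (\<Sum>m<j. of_int (d m) * of_int ((vs ! m) 0))"
        using d0' by simp
      also have "\<dots> = - (\<Sum>m<j. of_int (d m) * (z i * of_int ((vs ! m) 0) - of_int ((vs ! m) i)))"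
        by (simp add: sum_distrib_left sum_subtractf sum_negf algebra_simps)
      finally have "\<bar>real_of_int (\<Sum>m<j. d m * (vs ! m) i)\<bar> =
          \<bar>\<Sum>m<j. of_int (d m) * (z i * of_int ((vs ! m) 0) - of_int ((vs ! m) i))\<bar>"
        by simp
      also have "\<dots> \<le> (\<Sum>m<j. \<bar>of_int (d m) * (z i * of_int ((vs ! m) 0) - of_int ((vs ! m) i))\<bar>)"
        by (rule sum_abs)
      also have "\<dots> \<le> (\<Sum>m<j. real H * X powr (-\<eta>))"
      proof (rule sum_mono)
        fix m assume "m \<in> {..<j}"
        then have m: "m < j" by simp
        have "\<bar>z i * of_int ((vs ! m) 0) - of_int ((vs ! m) i)\<bar> \<le> X powr (-\<eta>)"
          using sol[OF m] that False unfolding approx_sols_def by auto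
        then show "\<bar>of_int (d m) * (z i * of_int ((vs ! m) 0) - of_int ((vs ! m) i))\<bar> \<le> real H * X powr (-\<eta>)"
          unfolding abs_mult using dH[OF m] by (intro mult_mono) auto
      qed
      also have "\<dots> < 1" using small by simp
      finally show ?thesis by linarith
    qed
    then have "d m = 0" if "m < j" for m
      using lin_indep_vecs_int[OF vs(3), of d m] vs(1) that by simp
    then have "c m = c' m" if "m < j" for m
      using that unfolding d_def by force
    then show "c = c'"
      using c unfolding S_def by (intro PiE_ext) auto
  qed
  moreover have "F ` S \<subseteq> {-M..M}"
  proof
    fix y assume "y \<in> F ` S"
    then obtain c where c: "c \<in> S" "y = F c" by blast
    have "\<bar>real_of_int (F c)\<bar> = \<bar>\<Sum>m<j. real (c m) * of_int ((vs ! m) 0)\<bar>"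
      unfolding F_def by simp
    also have "\<dots> \<le> (\<Sum>m<j. \<bar>real (c m) * of_int ((vs ! m) 0)\<bar>)"
      by (rule sum_abs)
    also have "\<dots> \<le> (\<Sum>m<j. real H * X)"
    proof (rule sum_mono)
      fix m assume "m \<in> {..<j}"
      then have m: "m < j" by simp
      have "\<bar>real_of_int ((vs ! m) 0)\<bar> \<le> X"
        using sol[OF m] unfolding approx_sols_def by auto
      moreover have "real (c m) \<le> real H"
        using c m unfolding S_def PiE_iff by auto
      ultimately show "\<bar>real (c m) * of_int ((vs ! m) 0)\<bar> \<le> real H * X"
        unfolding abs_mult by (intro mult_mono) auto
    qed
    also have "\<dots> = real j * real H * X" by simp
    finally have "\<bar>real_of_int y\<bar> \<le> real j * real H * X" using c by simp
    then have "\<bar>y\<bar> \<le> M" unfolding M_def le_floor_iff by simp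
    then show "y \<in> {-M..M}" by auto
  qed
  ultimately have "card S \<le> card {-M..M}"
    by (metis card_inj_on_le finite_atLeastAtMost_int)
  also have "card {-M..M} = nat (2 * M + 1)" by simp
  finally have "int (card S) \<le> 2 * M + 1"
    using X unfolding M_def by (simp add: nat_le_eq_zle le_nat_iff)
  then have "real (card S) \<le> 2 * real_of_int M + 1"
    by linarith
  moreover have "card S = (H + 1) ^ j"
    unfolding S_def by (simp add: card_PiE)
  moreover have "real_of_int M \<le> real j * real H * X"
    unfolding M_def by simp
  ultimately show ?thesis by (simp add: add.commute)
qed

section \<open>Upper bound for the ordinary exponents\<close>

lemma powr_unbounded:
  fixes e K :: real
  assumes "e > 0"
  shows "\<exists>X1. \<forall>X\<ge>X1. X powr e > K"
proof (intro exI allI impI)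
  fix X :: real assume "X \<ge> (\<bar>K\<bar> + 1) powr (1 / e)"
  then have "((\<bar>K\<bar> + 1) powr (1 / e)) powr e \<le> X powr e"
    using assms by (intro powr_mono2) auto
  then show "X powr e > K" using assms by (simp add: powr_powr)
qed

text \<open>With \<open>H\<close> of order \<open>X powr \<eta>\<close> the count gives
  \<open>(H + 1) ^ (j - 1) \<le> 3 * j * X\<close>, which fails for large \<open>X\<close> once
  \<open>\<eta> * (j - 1) > 1\<close>.\<close>

lemma lambda_exp_le:
  assumes "j \<ge> 2"
  shows "lambda_exp k j z \<le> ereal (1 / (real j - 1))"
  unfolding lambda_exp_def
proof (rule Sup_least, clarsimp)
  fix \<eta> assume inf: "\<forall>X0. \<exists>X\<ge>X0. has_indep_sols k j z X \<eta>"
  show "\<eta> \<le> 1 / (real j - 1)"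
  proof (rule ccontr)
    assume "\<not> ?thesis"
    then have \<eta>: "\<eta> * (real j - 1) > 1" using assms by (simp add: field_simps)
    define e where "e = \<eta> * (real j - 1) - 1"
    define K where "K = 3 * real j * (2 * real j) ^ (j - 1)"
    have "e > 0" using \<eta> e_def by simp
    then obtain X1 where X1: "\<And>X. X \<ge> X1 \<Longrightarrow> X powr e > K"
      using powr_unbounded by blast
    obtain X where X: "X \<ge> max 1 X1" and h: "has_indep_sols k j z X \<eta>"
      using inf by blast
    have Xpos: "X > 0" "X \<ge> 1" using X by auto
    \<comment> \<open>The factor \<open>2 * j\<close> makes the accumulated error at most
      \<open>1/2\<close>, as the count requires a value below \<open>1\<close>.\<close>
    define t where "t = X powr \<eta> / (2 * real j)"
    define H where "H = nat \<lfloor>t\<rfloor>"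
    have t: "t > 0" using Xpos assms unfolding t_def by simp
    have Ht: "real H \<le> t" "t < real H + 1"
      using t unfolding H_def by (simp, linarith)
    have "real j * real H * X powr (-\<eta>) \<le> real j * t * X powr (-\<eta>)"
      using Ht by (intro mult_right_mono mult_left_mono) auto
    also have "\<dots> = 1/2"
      using assms Xpos unfolding t_def by (simp add: powr_minus field_simps)
    finally have c: "(real H + 1) ^ j \<le> 2 * (real j * real H * X) + 1"
      using Xpos by (intro indep_sols_count[OF h]) auto
    have jj: "(real H + 1) ^ j = (real H + 1) * (real H + 1) ^ (j - 1)"
      using assms by (simp add: power_eq_if)
    have jX: "1 \<le> real j * X"
      using assms Xpos mult_mono[of 1 "real j" 1 X] by simp
    have "2 * (real j * real H * X) + 1 \<le> 2 * (real j * X) * (real H + 1) + (real j * X) * (real H + 1)"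
      using jX mult_mono[of 1 "real j * X" 1 "real H + 1"] by (simp add: algebra_simps)
    then have "(real H + 1) * (real H + 1) ^ (j - 1) \<le> (real H + 1) * (3 * real j * X)"
      using c unfolding jj by (simp add: algebra_simps)
    then have "(real H + 1) ^ (j - 1) \<le> 3 * real j * X"
      by (metis mult_le_cancel_left_pos of_nat_0_less_iff of_nat_Suc zero_less_Suc add.commute)
    moreover have "t ^ (j - 1) \<le> (real H + 1) ^ (j - 1)"
      using t Ht by (intro power_mono) auto
    moreover have "t ^ (j - 1) = X powr (\<eta> * (real j - 1)) / (2 * real j) ^ (j - 1)"
      using Xpos assms unfolding t_def
      by (simp add: power_divide powr_powr of_nat_diff flip: powr_realpow)
    moreover have "X powr (\<eta> * (real j - 1)) = X * X powr e"
      using Xpos unfolding e_def by (simp add: powr_diff)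
    ultimately have "X * X powr e / (2 * real j) ^ (j - 1) \<le> 3 * real j * X"
      by simp
    then have "X * X powr e \<le> 3 * real j * X * (2 * real j) ^ (j - 1)"
      using assms by (simp add: pos_divide_le_eq)
    then have "X * X powr e \<le> X * K"
      unfolding K_def by (simp add: mult_ac)
    then have "X powr e \<le> K" using Xpos by simp
    then show False using X1[of X] X by simp
  qed
qed

text \<open>If all errors are below \<open>1/b\<close>, then \<open>v (i+1) = v i * a / b\<close> exactly, one coordinate after the other.\<close>

lemma rational_powers_rigid:
  fixes a b :: int and v :: "nat \<Rightarrow> int"
  assumes b: "b > 0"
    and small: "\<And>i. i \<in> {1..k} \<Longrightarrow> \<bar>(of_int a / of_int b) ^ i * of_int (v 0) - real_of_int (v i)\<bar> < 1 / of_int b"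
    and "i \<le> k"
  shows "v 0 * a ^ i = b ^ i * v i"
  using \<open>i \<le> k\<close>
proof (induction i)
  case (Suc i)
  then have IH: "real_of_int (v 0) * of_int a ^ i = of_int b ^ i * of_int (v i)"
    by (metis Suc_leD of_int_mult of_int_power)
  have "(of_int a / of_int b) ^ Suc i * of_int (v 0) = real_of_int (a * v i) / of_int b"
    using IH b by (simp add: field_simps)
  then have "\<bar>real_of_int (a * v i) / of_int b - of_int (v (Suc i))\<bar> < 1 / of_int b"
    using small[of "Suc i"] Suc.prems by (metis atLeastAtMost_iff le_simps(3) zero_less_Suc One_nat_def)
  then have "\<bar>real_of_int (a * v i - b * v (Suc i)) / of_int b\<bar> < 1 / of_int b"
    using b by (simp add: diff_divide_distrib)
  then have "\<bar>real_of_int (a * v i - b * v (Suc i))\<bar> < 1"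
    using b by (simp add: abs_divide divide_less_cancel)
  then have "a * v i = b * v (Suc i)" by linarith
  moreover have "v 0 * a ^ i = b ^ i * v i"
    using Suc by simp
  ultimately show ?case
    by (metis (no_types, lifting) mult.assoc mult.commute power_Suc)
qed simp

lemma singleton_lin_indep:
  assumes "i \<le> k" "v i \<noteq> 0"
  shows "lin_indep_vecs k [v]"
  unfolding lin_indep_vecs_def
proof (intro allI impI)
  fix c :: "nat \<Rightarrow> real" and m
  assume "\<forall>i\<le>k. (\<Sum>m<length [v]. c m * of_int (([v] ! m) i)) = 0" and m: "m < length [v]"
  then have "(\<Sum>m<length [v]. c m * of_int (([v] ! m) i)) = 0"
    using assms(1) by blast
  then show "c m = 0" using m assms(2) by simp
qed

lemma singleton_lin_indepD:
  assumes "lin_indep_vecs k [v]"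
  shows "\<exists>i\<le>k. v i \<noteq> 0"
proof (rule ccontr)
  assume "\<not> ?thesis"
  then have "(\<lambda>_::nat. 1::real) 0 = 0"
    using assms unfolding lin_indep_vecs_def
    by (elim allE[of _ "\<lambda>_. 1"]) auto
  then show False by simp
qed

text \<open>Reduces a lower bound for a supremum to one real exponent at a time;
  \<open>x = \<infinity>\<close> is included, which serves the case \<open>j = 1\<close>.\<close>

lemma ereal_le_if_reals_below:
  assumes "\<And>r. ereal r < x \<Longrightarrow> ereal r \<le> y"
  shows "x \<le> y"
proof (rule ccontr)
  assume "\<not> x \<le> y"
  then obtain r where "y < ereal r" "ereal r < x"
    using ereal_dense2[of y x] by (auto simp: not_le)
  then show False using assms[of r] by simp
qed

section \<open>Explicit solutions and lower bounds for the uniform exponents\<close>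

lemma has_indep_solsI:
  assumes "\<And>m. m < j \<Longrightarrow> w m \<in> approx_sols k z X \<eta>"
    and "\<And>c m. \<forall>i\<le>k. (\<Sum>m<j. c m * real_of_int (w m i)) = 0 \<Longrightarrow> m < j \<Longrightarrow> c m = 0"
  shows "has_indep_sols k j z X \<eta>"
  unfolding has_indep_sols_def
proof (intro exI conjI)
  show "set (map w [0..<j]) \<subseteq> approx_sols k z X \<eta>"
    using assms(1) by auto
  show "lin_indep_vecs k (map w [0..<j])"
    unfolding lin_indep_vecs_def
  proof (intro allI impI)
    fix c :: "nat \<Rightarrow> real" and m
    assume "\<forall>i\<le>k. (\<Sum>m<length (map w [0..<j]). c m * of_int ((map w [0..<j] ! m) i)) = 0"
      and "m < length (map w [0..<j])"
    then show "c m = 0" by (intro assms(2)) simp_all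
  qed
qed simp

text \<open>Dirichlet's theorem with \<open>N\<close> the integer part of
  \<open>X powr (1/k)\<close> gives errors below \<open>1/N\<close>; the slack
  \<open>1/k - \<eta>\<close> absorbs the factor \<open>2\<close> lost by rounding.\<close>

lemma lambda_hat_exp_1_ge:
  assumes k: "k \<ge> 1"
  shows "lambda_hat_exp k 1 z \<ge> ereal (1 / real k)"
proof (rule ereal_le_if_reals_below)
  fix \<eta> assume "ereal \<eta> < ereal (1 / real k)"
  then have "1 / real k - \<eta> > 0" by simp
  then obtain X1 where X1: "\<And>X. X \<ge> X1 \<Longrightarrow> X powr (1 / real k - \<eta>) > 2"
    using powr_unbounded by blast
  have "has_indep_sols k 1 z X \<eta>" if X: "X \<ge> max 1 X1" for X
  proof -
    define t where "t = X powr (1 / real k)"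
    define N where "N = nat \<lfloor>t\<rfloor>"
    have t: "t \<ge> 1" using X unfolding t_def by (simp add: ge_one_powr_ge_zero)
    have N: "real N \<le> t" "t < real N + 1" "N \<ge> 1"
      using t unfolding N_def by (simp, linarith, linarith)
    obtain x p where x: "0 < x" "x \<le> int (N ^ k)"
      and p: "\<And>i. i < k \<Longrightarrow> \<bar>of_int x * z (Suc i) - of_int (p i)\<bar> < 1 / N"
      using Dirichlet_approx_simult[of N k "\<lambda>i. z (Suc i)"] N(3) by auto
    define v where "v i = (if i = 0 then x else if i \<le> k then p (i - 1) else 0)" for i
    have "real_of_int x \<le> real N ^ k" using x(2) by (metis of_int_le_iff of_int_of_nat_eq of_nat_power)
    also have "\<dots> \<le> t ^ k" using N by (intro power_mono) auto
    also have "\<dots> = X" using X k unfolding t_def by (simp add: powr_powr flip: powr_realpow)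
    finally have xX: "\<bar>real_of_int x\<bar> \<le> X" using x by simp
    have "t \<le> 2 * real N" using N by linarith
    then have "1 / real N \<le> 2 / t" using t N by (simp add: field_simps)
    also have "\<dots> \<le> X powr (1 / real k - \<eta>) / t"
      using X1[of X] X t by (intro divide_right_mono) auto
    also have "\<dots> = X powr (-\<eta>)"
      using X unfolding t_def by (simp add: powr_diff powr_minus field_simps)
    finally have NX: "1 / real N \<le> X powr (-\<eta>)" .
    have "\<bar>z i * of_int (v 0) - of_int (v i)\<bar> \<le> X powr (-\<eta>)" if "i \<in> {1..k}" for i
    proof -
      have "i - 1 < k" "Suc (i - 1) = i" using that by auto
      then show ?thesis using p[of "i - 1"] that NX unfolding v_def by (auto simp: mult.commute)
    qed
    then have "v \<in> approx_sols k z X \<eta>"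
      unfolding approx_sols_def int_vec_def using xX by (auto simp: v_def)
    moreover have "lin_indep_vecs k [v]"
      using x by (intro singleton_lin_indep[of 0]) (auto simp: v_def)
    ultimately show ?thesis
      unfolding has_indep_sols_def by (intro exI[of _ "[v]"]) auto
  qed
  then show "ereal \<eta> \<le> lambda_hat_exp k 1 z"
    unfolding lambda_hat_exp_def by (intro Sup_upper) blast
qed

text \<open>At exponent \<open>0\<close> errors up to \<open>1\<close> are allowed, so rounding down
  at \<open>x = 1\<close> and the unit vectors with \<open>x = 0\<close> supply enough
  solutions.\<close>

lemma lambda_hat_exp_nonneg:
  assumes "j \<le> k + 1"
  shows "lambda_hat_exp k j z \<ge> 0"
proof -
  define w where "w m i = (if i > k then 0 else if m = 0 then (if i = 0 then 1 else \<lfloor>z i\<rfloor>)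
    else if i = m then 1 else 0)" for m i :: nat
  have "has_indep_sols k j z X 0" if "X \<ge> 1" for X
  proof (rule has_indep_solsI)
    fix m assume "m < j"
    show "w m \<in> approx_sols k z X 0"
      unfolding approx_sols_def int_vec_def using that
      by (auto simp: w_def abs_le_iff) linarith+
  next
    fix c :: "nat \<Rightarrow> real" and m
    assume c: "\<forall>i\<le>k. (\<Sum>m<j. c m * real_of_int (w m i)) = 0" and m: "m < j"
    have "(\<Sum>m<j. c m * real_of_int (w m 0)) = (\<Sum>m<j. if m = 0 then c 0 else 0)"
      by (intro sum.cong) (auto simp: w_def)
    then have c0: "c 0 = 0" using c m by auto
    have "(\<Sum>m'<j. c m' * real_of_int (w m' m)) = (\<Sum>m'<j. if m' = m then c m else 0)"
      using c0 m assms by (intro sum.cong) (auto simp: w_def)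
    then show "c m = 0" using c m assms by auto
  qed
  then have "ereal 0 \<le> lambda_hat_exp k j z"
    unfolding lambda_hat_exp_def by (intro Sup_upper) blast
  then show ?thesis by (simp add: zero_ereal_def)
qed

text \<open>Lipschitz bound by induction on \<open>i\<close>; \<open>1 \<le> M\<close> permits one
  constant for all \<open>i \<le> k\<close>.\<close>

lemma power_diff_le:
  fixes r z M :: real
  assumes "0 \<le> r" "r \<le> z" "z \<le> M" "1 \<le> M" "i \<le> k"
  shows "\<bar>z ^ i - r ^ i\<bar> \<le> real k * M ^ k * (z - r)"
proof -
  have "z ^ i - r ^ i \<le> real i * M ^ i * (z - r)"
  proof (induction i)
    case (Suc i)
    have "z ^ Suc i - r ^ Suc i = z * (z ^ i - r ^ i) + r ^ i * (z - r)"
      by (simp add: algebra_simps)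
    also have "z * (z ^ i - r ^ i) \<le> M * (real i * M ^ i * (z - r))"
      using Suc assms by (intro mult_mono) (auto intro: power_mono)
    also have "r ^ i * (z - r) \<le> M ^ Suc i * (z - r)"
      using assms power_mono[of r M i] power_increasing[of i "Suc i" M]
      by (intro mult_right_mono) linarith+
    finally show ?case by (simp add: algebra_simps)
  qed simp
  also have "\<dots> \<le> real k * M ^ k * (z - r)"
    using assms by (intro mult_right_mono mult_mono power_increasing) auto
  finally show ?thesis using power_mono[of r z i] assms by simp
qed

section \<open>Partial sums of the series\<close>

locale divisor_chain =
  fixes q :: "nat \<Rightarrow> nat" and \<zeta> :: real
  assumes q_pos: "l \<ge> 1 \<Longrightarrow> q l > 0"
    and q_dvd: "l \<ge> 1 \<Longrightarrow> q l dvd q (Suc l)"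
    and q_less: "l \<ge> 1 \<Longrightarrow> q l < q (Suc l)"
    and zeta: "\<zeta> = (\<Sum>l. 1 / real (q (l + 1)))"
begin

text \<open>Numerator of the \<open>n\<close>-th partial sum over the denominator
  \<open>q n\<close>; each division is exact by the divisor chain.\<close>

definition numer :: "nat \<Rightarrow> nat" where
  "numer n = (\<Sum>l<n. q n div q (Suc l))"

lemma q_dvd_q:
  assumes "l \<ge> 1" "l \<le> n"
  shows "q l dvd q n"
  using assms(2,1)
proof (induction rule: dec_induct)
  case (step n)
  then show ?case using q_dvd[of n] dvd_trans by simp
qed simp

lemma q_double:
  assumes "l \<ge> 1"
  shows "2 * q l \<le> q (Suc l)"
proof -
  obtain m where m: "q (Suc l) = q l * m" using q_dvd[OF assms] by blast
  then have "m \<noteq> 0" "m \<noteq> 1" using q_less[OF assms] by auto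
  then have "2 \<le> m" by simp
  then show ?thesis unfolding m by simp
qed

lemma q_geometric:
  assumes "n \<ge> 1"
  shows "2 ^ i * q n \<le> q (n + i)"
proof (induction i)
  case (Suc i)
  then show ?case using q_double[of "n + i"] assms by simp
qed simp

text \<open>Lets a prescribed threshold for \<open>X\<close> be met by choosing a large
  index.\<close>

lemma q_gt_index: "n < q (Suc n)"
proof -
  have "n < 2 ^ n * 1" by simp
  also have "\<dots> \<le> 2 ^ n * q 1" using q_pos[of 1] by (intro mult_le_mono2) simp
  also have "\<dots> \<le> q (Suc n)" using q_geometric[of 1 n] by simp
  finally show ?thesis .
qed

lemma inverse_q_le:
  assumes "n \<ge> 1"
  shows "1 / real (q (i + n)) \<le> (1/2) ^ i * (1 / real (q n))"
proof -
  have "2 ^ i * real (q n) \<le> real (q (i + n))"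
    using q_geometric[OF assms, of i] by (metis add.commute of_nat_le_iff of_nat_mult of_nat_numeral of_nat_power)
  moreover have "0 < 2 ^ i * real (q n)" using q_pos[OF assms] by simp
  ultimately have "1 / real (q (i + n)) \<le> 1 / (2 ^ i * real (q n))"
    by (intro divide_left_mono) auto
  then show ?thesis by (simp add: power_divide)
qed

lemma summable_q:
  assumes "n \<ge> 1"
  shows "summable (\<lambda>i. 1 / real (q (i + n)))"
proof (rule summable_comparison_test)
  show "\<exists>N. \<forall>i\<ge>N. norm (1 / real (q (i + n))) \<le> (1/2) ^ i * (1 / real (q n))"
    using inverse_q_le[OF assms] by auto
  show "summable (\<lambda>i. (1/2) ^ i * (1 / real (q n)))"
    by (intro summable_mult2 summable_geometric) simp
qed

lemma convergent_eq: "real (numer n) / real (q n) = (\<Sum>l<n. 1 / real (q (l + 1)))"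
proof (cases "n = 0")
  case False
  have "real (numer n) / real (q n) = (\<Sum>l<n. real (q n div q (Suc l)) / real (q n))"
    unfolding numer_def by (simp add: sum_divide_distrib)
  also have "\<dots> = (\<Sum>l<n. 1 / real (q (l + 1)))"
  proof (rule sum.cong[OF refl])
    fix l assume "l \<in> {..<n}"
    then have "q (Suc l) dvd q n" by (intro q_dvd_q) auto
    then show "real (q n div q (Suc l)) / real (q n) = 1 / real (q (l + 1))"
      using q_pos[of n] q_pos[of "Suc l"] False by (simp add: real_of_nat_div)
  qed
  finally show ?thesis .
qed (simp add: numer_def)

text \<open>The tail starts with \<open>1 / q (Suc n)\<close> and is dominated by a geometric series
  of ratio \<open>1/2\<close>, because a proper divisor is at most half.\<close>

lemma convergent_error:
  "real (numer n) / real (q n) \<le> \<zeta>" "\<zeta> - real (numer n) / real (q n) \<le> 2 / real (q (Suc n))"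
proof -
  have s: "summable (\<lambda>l. 1 / real (q (l + 1)))" using summable_q[of 1] by simp
  have eq: "\<zeta> - real (numer n) / real (q n) = (\<Sum>l. 1 / real (q (l + Suc n)))"
    using suminf_split_initial_segment[OF s, of n] unfolding convergent_eq zeta by simp
  have "0 \<le> (\<Sum>l. 1 / real (q (l + Suc n)))"
    by (intro suminf_nonneg summable_q) auto
  then show "real (numer n) / real (q n) \<le> \<zeta>" using eq by simp
  have "(\<Sum>l. 1 / real (q (l + Suc n))) \<le> (\<Sum>l. (1/2) ^ l * (1 / real (q (Suc n))))"
    by (intro suminf_le summable_q inverse_q_le summable_mult2 summable_geometric) auto
  also have "\<dots> = 2 / real (q (Suc n))"
    by (subst suminf_mult2[symmetric]) (auto simp: suminf_geometric)
  finally show "\<zeta> - real (numer n) / real (q n) \<le> 2 / real (q (Suc n))" using eq by simp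
qed

lemma zeta_le_2: "\<zeta> \<le> 2"
proof -
  have "2 / real (q 1) \<le> 2" using q_pos[of 1] by (simp add: field_simps)
  \<comment> \<open>For \<open>n = 0\<close> the partial sum is empty and the tail is the whole
    series.\<close>
  then show ?thesis using convergent_error(2)[of 0] by (simp add: numer_def)
qed

lemma power_convergent_error:
  assumes "i \<le> k"
  shows "\<bar>\<zeta> ^ i - (real (numer n) / real (q n)) ^ i\<bar> \<le> real k * 2 ^ (k + 1) / real (q (Suc n))"
proof -
  have "\<bar>\<zeta> ^ i - (real (numer n) / real (q n)) ^ i\<bar> \<le> real k * 2 ^ k * (\<zeta> - real (numer n) / real (q n))"
    using convergent_error(1) zeta_le_2 assms by (intro power_diff_le) auto
  also have "\<dots> \<le> real k * 2 ^ k * (2 / real (q (Suc n)))"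
    using convergent_error(2) by (intro mult_left_mono) auto
  finally show ?thesis by (simp add: mult_ac)
qed

text \<open>The old numerator is rescaled and the new term adds \<open>1\<close>; hence
  \<open>numer (Suc n)\<close> is coprime to the quotient of the denominators.\<close>

lemma numer_Suc:
  assumes "n \<ge> 1"
  shows "numer (Suc n) = numer n * (q (Suc n) div q n) + 1"
proof -
  have "q (Suc n) div q (Suc l) = (q n div q (Suc l)) * (q (Suc n) div q n)" if "l < n" for l
    using q_dvd_q[of "Suc l" n] q_dvd[OF assms] that q_pos[OF assms]
    by (metis One_nat_def Suc_leI div_mult_swap dvd_div_mult_self mult.commute zero_less_Suc le_simps(3))
  then show ?thesis
    using q_pos[of "Suc n"] unfolding numer_def by (simp add: sum_distrib_right)
qed

text \<open>The fraction \<open>numer (n+1) / q (n+1)\<close> need not be reduced (\<open>1/2 + 1/6 = 4/6\<close>), but the common factor divides \<open>q n\<close>.\<close>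

lemma reduced_convergent:
  assumes "n \<ge> 1"
  obtains a b :: nat where "coprime a b" "b > 0" "real (q (Suc n)) \<le> real b * real (q n)" "b \<le> q (Suc n)"
    "real (numer (Suc n)) / real (q (Suc n)) = real a / real b"
proof -
  define g where "g = gcd (numer (Suc n)) (q (Suc n))"
  define m where "m = q (Suc n) div q n"
  have Q: "q (Suc n) > 0" using q_pos by simp
  have qm: "q (Suc n) = q n * m" using q_dvd[OF assms] unfolding m_def by simp
  have g: "g > 0" "g dvd numer (Suc n)" "g dvd q (Suc n)" using Q unfolding g_def by auto
  have "coprime g m"
  proof (rule coprimeI)
    fix d assume d: "d dvd g" "d dvd m"
    then have "d dvd numer n * m + 1" using g numer_Suc[OF assms] unfolding m_def by (metis dvd_trans)
    then show "is_unit d" using d(2) by (metis dvd_add_right_iff dvd_mult)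
  qed
  then have "g dvd q n" using g(3) unfolding qm by (simp add: coprime_dvd_mult_left_iff)
  then have gq: "g \<le> q n" using q_pos[OF assms] by (simp add: dvd_imp_le)
  define a b where "a = numer (Suc n) div g" and "b = q (Suc n) div g"
  have ab: "numer (Suc n) = a * g" "q (Suc n) = b * g" unfolding a_def b_def using g by simp_all
  show thesis
  proof (rule that[of a b])
    show "coprime a b" unfolding a_def b_def g_def using Q by (intro div_gcd_coprime) simp
    show "b > 0" using ab Q by simp
    show "real (q (Suc n)) \<le> real b * real (q n)" unfolding ab(2) using gq by (simp add: mult_left_mono)
    show "b \<le> q (Suc n)" unfolding ab(2) using g by simp
    show "real (numer (Suc n)) / real (q (Suc n)) = real a / real b" unfolding ab using g by simp
  qed
qed

end

section \<open>Exponents of the series\<close>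

text \<open>Replacing \<open>z i\<close> by the power of \<open>a/b\<close> costs at most
  \<open>X * E\<close>, after which \<open>rational_powers_rigid\<close> applies.\<close>

lemma approx_sols_rigid:
  fixes a b :: int
  assumes v: "v \<in> approx_sols k z X \<eta>" and b: "b > 0"
    and E: "\<And>i. i \<in> {1..k} \<Longrightarrow> \<bar>z i - (of_int a / of_int b) ^ i\<bar> \<le> E"
    and small: "X powr (-\<eta>) + X * E < 1 / of_int b"
    and "i \<le> k"
  shows "v 0 * a ^ i = b ^ i * v i"
proof (rule rational_powers_rigid[OF b _ \<open>i \<le> k\<close>])
  fix i assume i: "i \<in> {1..k}"
  have "\<bar>z i * of_int (v 0) - of_int (v i)\<bar> \<le> X powr (-\<eta>)" "\<bar>real_of_int (v 0)\<bar> \<le> X"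
    using v i unfolding approx_sols_def by auto
  moreover have "\<bar>real_of_int (v 0) * (z i - (of_int a / of_int b) ^ i)\<bar> \<le> X * E"
    unfolding abs_mult using E[OF i] \<open>\<bar>real_of_int (v 0)\<bar> \<le> X\<close> by (intro mult_mono) auto
  ultimately show "\<bar>(of_int a / of_int b) ^ i * of_int (v 0) - real_of_int (v i)\<bar> < 1 / of_int b"
    using small by (simp add: algebra_simps abs_le_iff abs_less_iff)
qed

text \<open>The omitted terms have \<open>m > h\<close> and carry
  \<open>Q ^ h / Q ^ m \<le> 1 / Q\<close>, while all the weights together sum to
  \<open>(1 + r) ^ i\<close>.\<close>

lemma truncated_binomial_error:
  fixes r Q :: real
  assumes r: "0 \<le> r" and Q: "1 \<le> Q"
  shows "\<bar>Q ^ h * (r + 1 / Q) ^ i - (\<Sum>m\<le>h. of_nat (i choose m) * r ^ (i - m) * Q ^ (h - m))\<bar> \<le> (1 + r) ^ i / Q"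
proof -
  define f where "f m = of_nat (i choose m) * r ^ (i - m) * (Q ^ h / Q ^ m)" for m
  define n where "n = max i h"
  have "Q ^ h * (r + 1 / Q) ^ i = (\<Sum>m\<le>i. f m)"
    using binomial_ring[of "1 / Q" r i]
    by (simp add: f_def sum_distrib_left power_divide add.commute mult_ac)
  also have "\<dots> = (\<Sum>m\<le>n. f m)"
    by (intro sum.mono_neutral_left) (auto simp: n_def f_def)
  finally have 1: "Q ^ h * (r + 1 / Q) ^ i = (\<Sum>m\<le>n. f m)" .
  have 2: "(\<Sum>m\<le>h. of_nat (i choose m) * r ^ (i - m) * Q ^ (h - m)) = (\<Sum>m\<le>h. f m)"
    using Q by (intro sum.cong) (auto simp: f_def power_diff)
  have 3: "(\<Sum>m\<le>n. f m) - (\<Sum>m\<le>h. f m) = (\<Sum>m\<in>{..n} - {..h}. f m)"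
    by (subst sum_diff) (auto simp: n_def)
  have f0: "f m \<ge> 0" for m using r Q by (simp add: f_def)
  have "(\<Sum>m\<in>{..n} - {..h}. f m) \<le> (\<Sum>m\<in>{..n} - {..h}. of_nat (i choose m) * r ^ (i - m) * (1 / Q))"
  proof (rule sum_mono)
    fix m assume "m \<in> {..n} - {..h}"
    then have "Q ^ Suc h \<le> Q ^ m" using Q by (intro power_increasing) auto
    then have "Q ^ h / Q ^ m \<le> 1 / Q" using Q by (simp add: field_simps)
    then show "f m \<le> of_nat (i choose m) * r ^ (i - m) * (1 / Q)"
      unfolding f_def using r by (intro mult_left_mono) auto
  qed
  also have "\<dots> \<le> (\<Sum>m\<le>n. of_nat (i choose m) * r ^ (i - m) * (1 / Q))"
    using r Q by (intro sum_mono2) auto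
  also have "\<dots> = (\<Sum>m\<le>i. of_nat (i choose m) * r ^ (i - m) * (1 / Q))"
    by (intro sum.mono_neutral_right) (auto simp: n_def)
  also have "\<dots> = (1 + r) ^ i / Q"
    using binomial_ring[of 1 r i] by (simp add: sum_divide_distrib)
  finally have "(\<Sum>m\<in>{..n} - {..h}. f m) \<le> (1 + r) ^ i / Q" .
  moreover have "(\<Sum>m\<in>{..n} - {..h}. f m) \<ge> 0" by (intro sum_nonneg f0)
  ultimately show ?thesis using 1 2 3 by linarith
qed

text \<open>The vectors \<open>\<Sum>m\<le>h. (i choose m) * r ^ (i - m) * Q ^ (h - m)\<close>, \<open>h < j\<close>, are obtained from the
  unitriangular family \<open>(i choose m) * r ^ (i - m)\<close>, \<open>m < j\<close>, by a unitriangular change of basis with entries \<open>Q ^ (h - m)\<close>.\<close>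

lemma truncated_binomial_indep:
  fixes r Q :: real and c :: "nat \<Rightarrow> real"
  assumes zero: "\<And>i. i \<le> k \<Longrightarrow> (\<Sum>h<j. c h * (\<Sum>m\<le>h. of_nat (i choose m) * r ^ (i - m) * Q ^ (h - m))) = 0"
    and j: "j \<le> k + 1" and h: "h < j"
  shows "c h = 0"
proof -
  define d where "d m = (\<Sum>h\<in>{m..<j}. c h * Q ^ (h - m))" for m
  have swap: "(\<Sum>m<j. of_nat (i choose m) * r ^ (i - m) * d m) = 0" if "i \<le> k" for i
  proof -
    have "(\<Sum>m<j. of_nat (i choose m) * r ^ (i - m) * d m) =
        (\<Sum>m<j. \<Sum>h\<in>{m..<j}. c h * (of_nat (i choose m) * r ^ (i - m) * Q ^ (h - m)))"
      unfolding d_def by (simp add: sum_distrib_left mult_ac)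
    also have "\<dots> = (\<Sum>m<j. \<Sum>h<j. if m \<le> h then c h * (of_nat (i choose m) * r ^ (i - m) * Q ^ (h - m)) else 0)"
      by (intro sum.cong refl sum.mono_neutral_cong_left) auto
    also have "\<dots> = (\<Sum>h<j. \<Sum>m<j. if m \<le> h then c h * (of_nat (i choose m) * r ^ (i - m) * Q ^ (h - m)) else 0)"
      by (rule sum.swap)
    also have "\<dots> = (\<Sum>h<j. \<Sum>m\<le>h. c h * (of_nat (i choose m) * r ^ (i - m) * Q ^ (h - m)))"
      by (intro sum.cong refl sum.mono_neutral_cong_right) auto
    also have "\<dots> = 0" using zero[OF that] by (simp add: sum_distrib_left)
    finally show ?thesis .
  qed
  have d0: "d m = 0" if "m < j" for m
    using that
  proof (induction m rule: less_induct)
    case (less m)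
    \<comment> \<open>Row \<open>i = m\<close> of the triangular system: later binomial coefficients
      are \<open>0\<close>, earlier \<open>d m'\<close> vanish by induction.\<close>
    have "of_nat (m choose m') * r ^ (m - m') * d m' = (if m' = m then d m else 0)" if "m' < j" for m'
      using less.IH[of m'] that by (cases m' m rule: linorder_cases) auto
    then have "(\<Sum>m'<j. of_nat (m choose m') * r ^ (m - m') * d m') = (\<Sum>m'<j. if m' = m then d m else 0)"
      by (intro sum.cong) auto
    also have "\<dots> = d m" using less.prems by simp
    finally show ?case using swap[of m] less.prems j by simp
  qed
  have "d (Suc h) = 0"
    using d0[of "Suc h"] unfolding d_def by (cases "Suc h < j") auto
  moreover have "d h = c h + Q * d (Suc h)"
  proof -
    have "d h = c h + (\<Sum>h'\<in>{Suc h..<j}. c h' * Q ^ (h' - h))"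
      unfolding d_def using h by (simp add: sum.atLeast_Suc_lessThan)
    also have "(\<Sum>h'\<in>{Suc h..<j}. c h' * Q ^ (h' - h)) = Q * d (Suc h)"
      unfolding d_def sum_distrib_left
    proof (rule sum.cong[OF refl])
      fix h' assume "h' \<in> {Suc h..<j}"
      then have "h' - h = Suc (h' - Suc h)" by auto
      then show "c h' * Q ^ (h' - h) = Q * (c h' * Q ^ (h' - Suc h))" by simp
    qed
    finally show ?thesis .
  qed
  ultimately show ?thesis using d0[OF h] by simp
qed

section \<open>The gap condition as power inequalities\<close>

lemma powr_le_if_log_ratio:
  fixes x y C :: real
  assumes "x > 1" "y > 0" "ln y / ln x > C"
  shows "x powr C \<le> y"
proof -
  have "C * ln x < ln y" using assms by (simp add: field_simps)
  then have "exp (C * ln x) \<le> exp (ln y)" by simp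
  then show ?thesis using assms by (simp add: powr_def)
qed

locale lacunary_chain = divisor_chain +
  fixes k :: nat
  assumes k: "k \<ge> 1"
    and gaps: "C > 0 \<Longrightarrow> \<exists>n\<ge>1. ln (real (q (Suc n))) / ln (real (q n)) > C \<and>
      ln (real (q (Suc (Suc n)))) / ln (real (q (Suc n))) > real k + 1"
begin

text \<open>\<open>C\<close> is chosen above all log ratios up to index \<open>N\<close>, which
  forces \<open>n > N\<close>, and large enough to absorb \<open>D\<close> as a power of
  \<open>q n \<ge> 2\<close>.\<close>

lemma large_gap:
  fixes D s \<delta> :: real
  assumes \<delta>: "\<delta> > 0"
  obtains n where "n \<ge> N" "n \<ge> 1" "D * real (q n) powr s < real (q (Suc n)) powr \<delta>"
    "real (q (Suc n)) ^ (k + 1) \<le> real (q (Suc (Suc n)))"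
proof -
  obtain E where E: "D < 2 ^ E" using real_arch_pow[of 2 D] by auto
  define rat where "rat n = \<bar>ln (real (q (Suc n))) / ln (real (q n))\<bar>" for n
  define C where "C = 1 + \<bar>(real E + s) / \<delta>\<bar> + (\<Sum>n\<le>N. rat n)"
  have S: "(\<Sum>n\<le>N. rat n) \<ge> 0" by (intro sum_nonneg) (simp add: rat_def)
  then have C: "C > 0" "C \<ge> (real E + s) / \<delta>" unfolding C_def by linarith+
  obtain n where n: "n \<ge> 1" and n1: "ln (real (q (Suc n))) / ln (real (q n)) > C"
    and n2: "ln (real (q (Suc (Suc n)))) / ln (real (q (Suc n))) > real k + 1"
    using gaps[OF C(1)] by blast
  have "n > N"
  proof (rule ccontr)
    assume "\<not> n > N"
    then have "rat n \<le> (\<Sum>n\<le>N. rat n)"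
      by (intro member_le_sum) (auto simp: rat_def)
    also have "\<dots> < C" unfolding C_def by linarith
    finally show False using n1 unfolding rat_def by linarith
  qed
  \<comment> \<open>For \<open>q n = 1\<close> the denominator \<open>ln 1\<close> is
    \<open>0\<close> and the quotient is \<open>0\<close> by convention, contradicting
    \<open>C > 0\<close>.\<close>
  have "q n \<noteq> 1" using n1 C by auto
  then have q2: "q n \<ge> 2" using q_pos[OF n] by linarith
  have Q2: "q (Suc n) > 1" using q2 q_less[OF n] by linarith
  have QQ: "q (Suc (Suc n)) > 0" using q_pos by simp
  have "D * real (q n) powr s < 2 ^ E * real (q n) powr s"
    using E q2 by (intro mult_strict_right_mono) auto
  also have "\<dots> \<le> real (q n) ^ E * real (q n) powr s"
    using q2 by (intro mult_right_mono power_mono) auto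
  also have "\<dots> = real (q n) powr (real E + s)"
    using q2 by (simp add: powr_add powr_realpow)
  also have "\<dots> \<le> real (q n) powr (C * \<delta>)"
    using C(2) \<delta> q2 by (intro powr_mono) (auto simp: pos_divide_le_eq)
  also have "\<dots> = (real (q n) powr C) powr \<delta>" by (simp add: powr_powr)
  also have "\<dots> \<le> real (q (Suc n)) powr \<delta>"
    using powr_le_if_log_ratio[OF _ _ n1] q2 Q2 \<delta> by (intro powr_mono2) auto
  finally have g1: "D * real (q n) powr s < real (q (Suc n)) powr \<delta>" .
  have "real (q (Suc n)) powr (real k + 1) \<le> real (q (Suc (Suc n)))"
    using powr_le_if_log_ratio[OF _ _ n2] Q2 QQ by simp
  moreover have "real (q (Suc n)) powr (real k + 1) = real (q (Suc n)) ^ (k + 1)"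
    using Q2 by (subst powr_realpow[symmetric]) (auto simp: add.commute)
  ultimately show thesis using that[of n] g1 n \<open>n > N\<close> by simp
qed

text \<open>All errors are at most \<open>D * b ^ k / Q\<close>; for
  \<open>X = b ^ k * Q ^ (j - 1)\<close> this is below \<open>X powr (-\<eta>)\<close> as soon as
  \<open>D * b powr (k * (1 + \<eta>))\<close> is below
  \<open>Q powr (1 - (j - 1) * \<eta>)\<close>.\<close>

lemma le_lambda_exp:
  assumes j: "1 \<le> j" "j \<le> k + 1" and \<eta>: "0 \<le> \<eta>" "(real j - 1) * \<eta> < 1"
  shows "ereal \<eta> \<le> lambda_exp k j (\<lambda>i. \<zeta> ^ i)"
proof -
  \<comment> \<open>\<open>3 ^ k\<close> pays for truncating the binomial expansion, the other
    summand for the tail of the series.\<close>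
  define D where "D = 3 ^ k + real k * 2 ^ (k + 1)"
  have "\<exists>X\<ge>X0. has_indep_sols k j (\<lambda>i. \<zeta> ^ i) X \<eta>" for X0
  proof -
    obtain n where n: "n \<ge> nat \<lceil>X0\<rceil>" "n \<ge> 1"
      and g1: "D * real (q n) powr (real k * (1 + \<eta>)) < real (q (Suc n)) powr (1 - (real j - 1) * \<eta>)"
      and g2: "real (q (Suc n)) ^ (k + 1) \<le> real (q (Suc (Suc n)))"
      using large_gap[of "1 - (real j - 1) * \<eta>" "nat \<lceil>X0\<rceil>" D "real k * (1 + \<eta>)"] \<eta> by auto
    define a b Q where "a = numer n" and "b = q n" and "Q = q (Suc n)"
    define r where "r = real a / real b"
    define X where "X = real b ^ k * real Q ^ (j - 1)"
    have b: "b \<ge> 1" and Q: "Q \<ge> 1" using q_pos[of n] q_pos[of "Suc n"] n unfolding b_def Q_def by auto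
    have r: "0 \<le> r" "r \<le> 2" using convergent_error(1)[of n] zeta_le_2 unfolding r_def a_def b_def by auto
    have rQ: "real (numer (Suc n)) / real Q = r + 1 / real Q"
      unfolding r_def a_def b_def Q_def convergent_eq by simp
    have Xpos: "X > 0" using b Q unfolding X_def by simp
    have "X0 \<le> real n" using n by linarith
    also have "\<dots> \<le> real b" using q_gt_index[of "n - 1"] n unfolding b_def by simp
    also have "\<dots> \<le> real b ^ k" using b k by (intro self_le_power) auto
    also have "\<dots> \<le> X"
      unfolding X_def using Q mult_left_mono[of 1 "real Q ^ (j - 1)" "real b ^ k"] by simp
    finally have XX0: "X0 \<le> X" .
    define T where "T h i = (\<Sum>m\<le>h. of_nat (i choose m) * r ^ (i - m) * real Q ^ (h - m))" for h i
    \<comment> \<open>The factor \<open>b ^ k\<close> clears the denominators of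
      \<open>r ^ (i - m)\<close>; where \<open>i - m\<close> is cut off at \<open>0\<close> the
      binomial coefficient vanishes.\<close>
    define w where "w h i = (if i > k then 0 else
      int (\<Sum>m\<le>h. (i choose m) * a ^ (i - m) * b ^ (k + m - i) * Q ^ (h - m)))" for h i
    have wT: "real_of_int (w h i) = real b ^ k * T h i" if "i \<le> k" for h i
    proof -
      have summand: "real ((i choose m) * a ^ (i - m) * b ^ (k + m - i) * Q ^ (h - m)) =
          real b ^ k * (of_nat (i choose m) * r ^ (i - m) * real Q ^ (h - m))" for m
      proof (cases "m \<le> i")
        case True
        then have "real b ^ k = real b ^ (k + m - i) * real b ^ (i - m)"
          using that by (simp flip: power_add)
        then show ?thesis using b by (simp add: r_def power_divide)
      qed simp
      have "real_of_int (w h i) = (\<Sum>m\<le>h. real ((i choose m) * a ^ (i - m) * b ^ (k + m - i) * Q ^ (h - m)))"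
        using that unfolding w_def by simp
      also have "\<dots> = real b ^ k * T h i"
        unfolding T_def sum_distrib_left by (intro sum.cong refl summand)
      finally show ?thesis .
    qed
    have w0: "real_of_int (w h 0) = real b ^ k * real Q ^ h" for h
    proof -
      have "T h 0 = (\<Sum>m\<le>h. if m = 0 then real Q ^ h else 0)"
        unfolding T_def by (intro sum.cong) auto
      then show ?thesis unfolding wT[OF le0] by simp
    qed
    have err: "\<bar>\<zeta> ^ i * of_int (w h 0) - of_int (w h i)\<bar> \<le> D * real b ^ k / real Q" if "i \<le> k" "h \<le> k" for h i
    proof -
      have "\<bar>\<zeta> ^ i - (r + 1 / real Q) ^ i\<bar> \<le> real k * 2 ^ (k + 1) / real (q (Suc (Suc n)))"
        using power_convergent_error[OF \<open>i \<le> k\<close>, of "Suc n"] rQ unfolding Q_def by simp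
      also have "\<dots> \<le> real k * 2 ^ (k + 1) / real Q ^ (k + 1)"
        using g2 Q q_pos unfolding Q_def by (intro divide_left_mono mult_pos_pos) auto
      \<comment> \<open>The exponent \<open>k + 1\<close> in \<open>g2\<close> leaves a factor
        \<open>1 / Q\<close> after multiplication by \<open>Q ^ h \<le> Q ^ k\<close>.\<close>
      finally have "real Q ^ h * \<bar>\<zeta> ^ i - (r + 1 / real Q) ^ i\<bar> \<le>
          real Q ^ k * (real k * 2 ^ (k + 1) / real Q ^ (k + 1))"
        using Q that by (intro mult_mono power_increasing) auto
      also have "\<dots> = real k * 2 ^ (k + 1) / real Q" using Q by simp
      finally have e1: "\<bar>real Q ^ h * (\<zeta> ^ i - (r + 1 / real Q) ^ i)\<bar> \<le> real k * 2 ^ (k + 1) / real Q"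
        by (simp add: abs_mult)
      have "\<bar>real Q ^ h * (r + 1 / real Q) ^ i - T h i\<bar> \<le> (1 + r) ^ i / real Q"
        unfolding T_def using r Q by (intro truncated_binomial_error) auto
      also have "\<dots> \<le> 3 ^ k / real Q"
      proof -
        have "(1 + r) ^ i \<le> 3 ^ i" using r by (intro power_mono) auto
        also have "\<dots> \<le> 3 ^ k" using that by (intro power_increasing) auto
        finally show ?thesis by (intro divide_right_mono) auto
      qed
      finally have e2: "\<bar>real Q ^ h * (r + 1 / real Q) ^ i - T h i\<bar> \<le> 3 ^ k / real Q" .
      have "\<zeta> ^ i * of_int (w h 0) - of_int (w h i) =
          real b ^ k * (real Q ^ h * (\<zeta> ^ i - (r + 1 / real Q) ^ i) + (real Q ^ h * (r + 1 / real Q) ^ i - T h i))"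
        unfolding w0 wT[OF \<open>i \<le> k\<close>] by (simp add: algebra_simps)
      also have "\<bar>\<dots>\<bar> \<le> real b ^ k * (real k * 2 ^ (k + 1) / real Q + 3 ^ k / real Q)"
        unfolding abs_mult using e1 e2 by (intro mult_mono) auto
      also have "\<dots> = D * real b ^ k / real Q"
        unfolding D_def by (simp add: add_divide_distrib algebra_simps)
      finally show ?thesis .
    qed
    have Xpow: "X powr (-\<eta>) = real b powr (- (real k * \<eta>)) * real Q powr (- ((real j - 1) * \<eta>))"
      using b Q j unfolding X_def
      by (simp add: powr_mult powr_powr of_nat_diff flip: powr_realpow)
    have "D * real b ^ k / real Q = (D * real b powr (real k * (1 + \<eta>))) * (real b powr (- (real k * \<eta>)) / real Q)"
      using b by (simp add: powr_add powr_minus distrib_left powr_realpow field_simps)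
    also have "\<dots> \<le> real Q powr (1 - (real j - 1) * \<eta>) * (real b powr (- (real k * \<eta>)) / real Q)"
      using g1 unfolding b_def Q_def by (intro mult_right_mono) auto
    also have "\<dots> = X powr (-\<eta>)"
      unfolding Xpow using Q powr_add[of "real Q" 1 "- ((real j - 1) * \<eta>)"] by simp
    finally have DX: "D * real b ^ k / real Q \<le> X powr (-\<eta>)" .
    have "has_indep_sols k j (\<lambda>i. \<zeta> ^ i) X \<eta>"
    proof (rule has_indep_solsI)
      fix h assume h: "h < j"
      have "real Q ^ h \<le> real Q ^ (j - 1)" using h Q by (intro power_increasing) auto
      then have "\<bar>real_of_int (w h 0)\<bar> \<le> X"
        unfolding w0 X_def by (simp add: abs_mult mult_left_mono)
      moreover have "\<bar>\<zeta> ^ i * of_int (w h 0) - of_int (w h i)\<bar> \<le> X powr (-\<eta>)" if "i \<in> {1..k}" for i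
        using h j that by (intro order_trans[OF err DX]) auto
      moreover have "int_vec k (w h)" unfolding int_vec_def w_def by simp
      ultimately show "w h \<in> approx_sols k (\<lambda>i. \<zeta> ^ i) X \<eta>"
        unfolding approx_sols_def by blast
    next
      fix c :: "nat \<Rightarrow> real" and h
      assume c: "\<forall>i\<le>k. (\<Sum>h<j. c h * real_of_int (w h i)) = 0" and h: "h < j"
      have "(\<Sum>h<j. c h * T h i) = 0" if "i \<le> k" for i
      proof -
        have "real b ^ k * (\<Sum>h<j. c h * T h i) = (\<Sum>h<j. c h * real_of_int (w h i))"
          unfolding wT[OF that] by (simp add: sum_distrib_left mult_ac)
        also have "\<dots> = 0" using c that by blast
        finally show ?thesis using b by simp
      qed
      then show "c h = 0" unfolding T_def by (rule truncated_binomial_indep[OF _ j(2) h])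
    qed
    then show ?thesis using XX0 by blast
  qed
  then show ?thesis
    unfolding lambda_exp_def by (intro Sup_upper) blast
qed

text \<open>At \<open>X = sqrt Q\<close> both \<open>X powr (-\<eta>)\<close> and
  \<open>X / Q\<close> are bounded by a negative power of \<open>Q\<close>, so a large gap brings
  the errors below \<open>1 / q n\<close> and puts all solutions on one line.\<close>

lemma lambda_hat_exp_le_0:
  assumes j: "j \<ge> 2"
  shows "lambda_hat_exp k j (\<lambda>i. \<zeta> ^ i) \<le> 0"
  unfolding lambda_hat_exp_def
proof (rule Sup_least, clarify)
  fix \<eta> X0 assume all: "\<forall>X\<ge>X0. has_indep_sols k j (\<lambda>i. \<zeta> ^ i) X \<eta>"
  show "ereal \<eta> \<le> 0"
  proof (rule ccontr)
    assume "\<not> ereal \<eta> \<le> 0"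
    then have \<eta>: "\<eta> > 0" by simp
    \<comment> \<open>The cap at \<open>1\<close> ensures
      \<open>X / Q = Q powr (-1/2) \<le> Q powr (-(\<mu> / 2))\<close>.\<close>
    define \<mu> where "\<mu> = min \<eta> 1"
    define D where "D = 1 + real k * 2 ^ (k + 1)"
    have \<mu>: "\<mu> > 0" "\<mu> \<le> \<eta>" "\<mu> \<le> 1" using \<eta> unfolding \<mu>_def by auto
    obtain n where n: "n \<ge> nat \<lceil>X0\<^sup>2\<rceil>" "n \<ge> 1"
      and g: "D * real (q n) powr 1 < real (q (Suc n)) powr (\<mu> / 2)"
      using large_gap[of "\<mu> / 2" "nat \<lceil>X0\<^sup>2\<rceil>" D 1] \<mu> by auto
    define Q where "Q = real (q (Suc n))"
    define X where "X = sqrt Q"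
    have Q: "Q \<ge> 1" using q_pos[of "Suc n"] unfolding Q_def by simp
    have qn: "q n > 0" using q_pos n by simp
    have "X0\<^sup>2 \<le> Q" using n(1) q_gt_index[of n] unfolding Q_def by linarith
    then have "X \<ge> X0" unfolding X_def by (simp add: real_le_rsqrt)
    then obtain vs where vs: "length vs = j" "set vs \<subseteq> approx_sols k (\<lambda>i. \<zeta> ^ i) X \<eta>" "lin_indep_vecs k vs"
      using all unfolding has_indep_sols_def by blast
    have X: "X = Q powr (1/2)" unfolding X_def using Q by (simp add: powr_half_sqrt)
    have "X powr (-\<eta>) \<le> Q powr (- (\<mu> / 2))"
      unfolding X powr_powr using Q \<mu> by (intro powr_mono) auto
    moreover have "X / Q \<le> Q powr (- (\<mu> / 2))"
    proof -
      have "X / Q = Q powr (1/2 - 1)" using Q unfolding X powr_diff by simp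
      also have "\<dots> \<le> Q powr (- (\<mu> / 2))" using Q \<mu> by (intro powr_mono) auto
      finally show ?thesis .
    qed
    then have "X * (real k * 2 ^ (k + 1) / Q) \<le> real k * 2 ^ (k + 1) * Q powr (- (\<mu> / 2))"
      using mult_left_mono[of "X / Q" "Q powr (- (\<mu> / 2))" "real k * 2 ^ (k + 1)"] by (simp add: mult_ac)
    ultimately have "X powr (-\<eta>) + X * (real k * 2 ^ (k + 1) / Q) \<le> D / Q powr (\<mu> / 2)"
      unfolding D_def by (simp add: powr_minus_divide add_divide_distrib)
    also have "\<dots> < 1 / real (q n)"
      using g qn Q unfolding Q_def[symmetric] by (simp add: field_simps)
    finally have small: "X powr (-\<eta>) + X * (real k * 2 ^ (k + 1) / Q) < 1 / real_of_int (int (q n))"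
      by simp
    have rigid: "v 0 * int (numer n) ^ i = int (q n) ^ i * v i" if "v \<in> set vs" "i \<le> k" for v i
      using vs(2) that qn power_convergent_error[of _ k n]
      by (intro approx_sols_rigid[OF _ _ _ small]) (auto simp: Q_def)
    define v w where "v = vs ! 0" and "w = vs ! 1"
    have vw: "v \<in> set vs" "w \<in> set vs" using vs(1) j unfolding v_def w_def by auto
    have j': "j = Suc (Suc (j - 2))" using j by simp
    have sum2: "(\<Sum>m<length vs. d m * (vs ! m) i) = d 0 * v i + d 1 * w i"
      if "\<And>m. m \<ge> 2 \<Longrightarrow> d m = 0" for d :: "nat \<Rightarrow> int" and i
    proof -
      have "(\<Sum>m<Suc (Suc (j - 2)). d m * (vs ! m) i) = d 0 * v i + d 1 * w i"
        unfolding v_def w_def sum.lessThan_Suc_shift using that by simp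
      then show ?thesis using vs(1) j' by simp
    qed
    have dep: "w 0 * v i = v 0 * w i" if "i \<le> k" for i
    proof -
      have "int (q n) ^ i * (w 0 * v i) = w 0 * (int (q n) ^ i * v i)" by simp
      also have "\<dots> = v 0 * (w 0 * int (numer n) ^ i)"
        unfolding rigid[OF vw(1) that, symmetric] by simp
      also have "\<dots> = int (q n) ^ i * (v 0 * w i)"
        unfolding rigid[OF vw(2) that] by simp
      finally show ?thesis using qn by simp
    qed
    define d where "d m = (if m = 0 then w 0 else if m = 1 then - v 0 else 0)" for m :: nat
    have "d 1 = 0"
      by (rule lin_indep_vecs_int[OF vs(3)]) (use j vs(1) dep in \<open>auto simp: sum2 d_def\<close>)
    then have "v 0 = 0" unfolding d_def by simp
    then have v0: "v i = 0" if "i \<le> k" for i using rigid[OF vw(1) that] qn by simp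
    \<comment> \<open>Since \<open>v\<close> vanishes, coefficient \<open>1\<close> on
      \<open>v\<close> alone is a nontrivial relation.\<close>
    have "(\<lambda>m. if m = 0 then 1 else 0 :: int) (0::nat) = 0"
      by (rule lin_indep_vecs_int[OF vs(3)]) (use j vs(1) v0 in \<open>auto simp: sum2\<close>)
    then show False by simp
  qed
qed

text \<open>Reducedness makes \<open>b ^ k\<close> divide the first coordinate of every solution, so
  at \<open>X = b ^ k / M\<close> only the zero vector is left.\<close>

lemma lambda_hat_exp_1_le: "lambda_hat_exp k 1 (\<lambda>i. \<zeta> ^ i) \<le> ereal (1 / real k)"
  unfolding lambda_hat_exp_def
proof (rule Sup_least, clarify)
  fix \<eta> X0 assume all: "\<forall>X\<ge>X0. has_indep_sols k 1 (\<lambda>i. \<zeta> ^ i) X \<eta>"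
  show "ereal \<eta> \<le> ereal (1 / real k)"
  proof (rule ccontr)
    assume "\<not> ereal \<eta> \<le> ereal (1 / real k)"
    then have \<eta>: "real k * \<eta> - 1 > 0" using k by (simp add: field_simps)
    \<comment> \<open>Chosen so that \<open>X * E\<close> is exactly
      \<open>1 / (4 * b)\<close>.\<close>
    define M where "M = real k * 2 ^ (k + 3)"
    have M: "M > 1"
    proof -
      have "(2::real) ^ 1 \<le> 2 ^ (k + 3)" by (intro power_increasing) auto
      then have "1 * 2 \<le> real k * 2 ^ (k + 3)" using k by (intro mult_mono) auto
      then show ?thesis unfolding M_def by simp
    qed
    \<comment> \<open>For \<open>b \<ge> B\<close> the other error \<open>X powr (-\<eta>)\<close>
      is below \<open>1 / (4 * b)\<close> too.\<close>
    obtain B where B: "\<And>b. b \<ge> B \<Longrightarrow> b powr (real k * \<eta> - 1) > 4 * M powr \<eta>"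
      using powr_unbounded[OF \<eta>] by blast
    define D where "D = max 1 (max B (M * X0))"
    obtain n where n: "n \<ge> 1" and g1: "D * real (q n) powr 1 < real (q (Suc n)) powr 1"
      and g2: "real (q (Suc n)) ^ (k + 1) \<le> real (q (Suc (Suc n)))"
      using large_gap[of 1 0 D 1] by auto
    obtain a b where ab: "coprime a b" "b > 0" "real (q (Suc n)) \<le> real b * real (q n)" "b \<le> q (Suc n)"
      and conv: "real (numer (Suc n)) / real (q (Suc n)) = real a / real b"
      using reduced_convergent[OF n] by blast
    \<comment> \<open>Cancellation costs at most the factor \<open>q n\<close>, which the gap
      outweighs, so \<open>b\<close> is still large.\<close>
    have "D * real (q n) < real b * real (q n)" using g1 ab(3) by simp
    then have "real b > D" using q_pos[OF n] by simp
    then have b: "real b \<ge> 1" "real b \<ge> B" "real b \<ge> M * X0" unfolding D_def by auto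
    define X where "X = real b ^ k / M"
    have Xpos: "X > 0" using ab M unfolding X_def by simp
    have "M * X0 \<le> real b ^ k" using b k self_le_power[of "real b" k] by linarith
    then have "X \<ge> X0" using M unfolding X_def by (simp add: field_simps)
    then obtain vs where vs: "length vs = 1" "set vs \<subseteq> approx_sols k (\<lambda>i. \<zeta> ^ i) X \<eta>" "lin_indep_vecs k vs"
      using all unfolding has_indep_sols_def by blast
    then obtain v where "vs = [v]" by (metis One_nat_def length_0_conv length_Suc_conv)
    then have v: "v \<in> approx_sols k (\<lambda>i. \<zeta> ^ i) X \<eta>" "lin_indep_vecs k [v]" using vs by auto
    define E where "E = real k * 2 ^ (k + 1) / real b ^ (k + 1)"
    have E: "\<bar>\<zeta> ^ i - (of_int (int a) / of_int (int b)) ^ i\<bar> \<le> E" if "i \<in> {1..k}" for i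
    proof -
      have "real b ^ (k + 1) \<le> real (q (Suc n)) ^ (k + 1)" using ab by (intro power_mono) auto
      then have bq: "real b ^ (k + 1) \<le> real (q (Suc (Suc n)))" using g2 by linarith
      have "\<bar>\<zeta> ^ i - (real a / real b) ^ i\<bar> \<le> real k * 2 ^ (k + 1) / real (q (Suc (Suc n)))"
        using power_convergent_error[of i k "Suc n"] that unfolding conv by simp
      also have "\<dots> \<le> E" unfolding E_def using bq ab q_pos by (intro divide_left_mono mult_pos_pos) auto
      finally show ?thesis by simp
    qed
    have "X powr (-\<eta>) = M powr \<eta> * real b powr (- (real k * \<eta>))"
      using ab M unfolding X_def
      by (simp add: powr_divide powr_powr powr_minus field_simps flip: powr_realpow)
    also have "\<dots> = M powr \<eta> / real b powr (real k * \<eta> - 1) / real b"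
      using ab by (simp add: powr_diff powr_minus field_simps)
    also have "\<dots> < 1 / 4 / real b"
      using B[OF b(2)] ab M by (intro divide_strict_right_mono) (simp_all add: divide_simps)
    finally have e1: "X powr (-\<eta>) < 1 / (4 * real b)" by simp
    have e2: "X * E = 1 / (4 * real b)"
      using ab k unfolding X_def E_def M_def by (simp add: power_add field_simps)
    have small: "X powr (-\<eta>) + X * E < 1 / of_int (int b)"
      using e1 e2 ab by (simp add: field_simps)
    have rigid: "v 0 * int a ^ i = int b ^ i * v i" if "i \<le> k" for i
      using approx_sols_rigid[OF v(1) _ E small that] ab by simp
    have "int b ^ k dvd v 0 * int a ^ k" using rigid[of k] by simp
    moreover have "coprime (int b ^ k) (int a ^ k)" using ab by (simp add: coprime_commute)
    ultimately have dv: "int b ^ k dvd v 0" by (simp add: coprime_dvd_mult_left_iff)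
    have "\<bar>real_of_int (v 0)\<bar> \<le> X" using v(1) unfolding approx_sols_def by simp
    also have "\<dots> < real b ^ k" using M ab unfolding X_def by (simp add: field_simps)
    finally have "\<bar>v 0\<bar> < int b ^ k" by (metis of_int_abs of_int_less_iff of_int_of_nat_eq of_int_power)
    then have "v 0 = 0" using dv zdvd_not_zless[of "\<bar>v 0\<bar>" "int b ^ k"] by (metis dvd_abs_iff zero_less_abs_iff)
    then have "v i = 0" if "i \<le> k" for i using rigid[OF that] ab by simp
    then show False using singleton_lin_indepD[OF v(2)] by blast
  qed
qed

end

theorem theorem7:
  fixes k :: nat and q :: "nat \<Rightarrow> nat" and \<zeta> :: real
  assumes "k \<ge> 1"
    and "\<forall>l\<ge>1. q l > 0"
    and "\<forall>l\<ge>1. q l dvd q (l + 1) \<and> q l < q (l + 1)"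
    and "\<forall>C>0. \<exists>n\<ge>1. ln (real (q (n + 1))) / ln (real (q n)) > C \<and>
                        ln (real (q (n + 2))) / ln (real (q (n + 1))) > real k + 1"
    and "\<zeta> = (\<Sum>l. 1 / real (q (l + 1)))"
  shows "(\<forall>j\<in>{1..k+1}. lambda_exp k j (\<lambda>i. \<zeta> ^ i) =
              (if j = 1 then \<infinity> else ereal (1 / (real j - 1))))
       \<and> lambda_hat_exp k 1 (\<lambda>i. \<zeta> ^ i) = ereal (1 / real k)
       \<and> (\<forall>j\<in>{2..k+1}. lambda_hat_exp k j (\<lambda>i. \<zeta> ^ i) = 0)"
proof -
  interpret lacunary_chain q \<zeta> k
  proof
    show "q l > 0" "q l dvd q (Suc l)" "q l < q (Suc l)" if "l \<ge> 1" for l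
      using assms(2,3) that by auto
    show "\<exists>n\<ge>1. ln (real (q (Suc n))) / ln (real (q n)) > C \<and>
        ln (real (q (Suc (Suc n)))) / ln (real (q (Suc n))) > real k + 1" if "C > 0" for C
      using assms(4)[rule_format, OF that] by simp
  qed (fact assms(5) assms(1))+
  have "lambda_exp k j (\<lambda>i. \<zeta> ^ i) = (if j = 1 then \<infinity> else ereal (1 / (real j - 1)))"
    if j: "j \<in> {1..k+1}" for j
  proof (cases "j = 1")
    case True
    have "\<infinity> \<le> lambda_exp k j (\<lambda>i. \<zeta> ^ i)"
    proof (rule ereal_le_if_reals_below)
      fix \<eta>
      \<comment> \<open>\<open>le_lambda_exp\<close> asks for a nonnegative exponent; its other
        condition reads \<open>0 < 1\<close> when \<open>j = 1\<close>.\<close>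
      have "ereal \<eta> \<le> ereal (max 0 \<eta>)" by simp
      also have "\<dots> \<le> lambda_exp k j (\<lambda>i. \<zeta> ^ i)"
        using j True by (intro le_lambda_exp) auto
      finally show "ereal \<eta> \<le> lambda_exp k j (\<lambda>i. \<zeta> ^ i)" .
    qed
    then show ?thesis using True by simp
  next
    case False
    then have j2: "j \<ge> 2" using j by auto
    have "ereal (1 / (real j - 1)) \<le> lambda_exp k j (\<lambda>i. \<zeta> ^ i)"
    proof (rule ereal_le_if_reals_below)
      fix \<eta> assume "ereal \<eta> < ereal (1 / (real j - 1))"
      then have "(real j - 1) * max 0 \<eta> < 1" using j2 by (auto simp: max_def field_simps)
      then have "ereal (max 0 \<eta>) \<le> lambda_exp k j (\<lambda>i. \<zeta> ^ i)"
        using j by (intro le_lambda_exp) auto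
      then show "ereal \<eta> \<le> lambda_exp k j (\<lambda>i. \<zeta> ^ i)"
        by (rule order_trans[rotated]) simp
    qed
    then show ?thesis using lambda_exp_le[OF j2, of k "\<lambda>i. \<zeta> ^ i"] False by simp
  qed
  moreover have "lambda_hat_exp k 1 (\<lambda>i. \<zeta> ^ i) = ereal (1 / real k)"
    using lambda_hat_exp_1_le lambda_hat_exp_1_ge[OF assms(1)] by (intro antisym)
  moreover have "lambda_hat_exp k j (\<lambda>i. \<zeta> ^ i) = 0" if "j \<in> {2..k+1}" for j
    using that lambda_hat_exp_le_0 lambda_hat_exp_nonneg by (intro antisym) auto
  ultimately show ?thesis by blast
qed

end
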